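(* Let $G$ be a group of orientation-preserving homeomorphisms of the interval $\bar I=[0,1]$, and let $I=(0,1)$. Suppose $G$ satisfies at least one of the following conditions: (1) $G$ is finitely generated and there are no fixed points of the group in $(0,1)$, i.e. no point $p\in(0,1)$ with $g(p)=p$ for all $g\in G$. (2) There exists at least one element $g\in G$ whose fixed points do not accumulate at $0$ and do not accumulate at $1$. Then every nonempty $G$-invariant subset $M\subseteq I$ that is closed with respect to $I$ contains a nonempty $G$-invariant subset $K\subseteq M$, closed with respect to $I$, which is minimal under those properties (i.e. no proper subset of $K$ is nonempty, $G$-invariant and closed with respect to $I$).
   Context: A subset $M\subseteq I$ is $G$-invariant if $g(M)=M$ for all $g\in G$. "Closed with respect to $I$" means closed in the subspace topology of $I=(0,1)$. The fixed points of $g$ accumulate at $0$ (resp. $1$) if every neighborhood of $0$ (resp. $1$) contains a fixed point of $g$ lying in $(0,1)$. *)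

theory Defs
  imports
    "HOL-Analysis.Analysis"
    "HOL-Algebra.Bij"
    "HOL-Algebra.Generated_Groups"
begin

definition orientation_preserving_homeo :: "(real \<Rightarrow> real) \<Rightarrow> bool" where
  "orientation_preserving_homeo f \<longleftrightarrow>
     (\<exists>f'. homeomorphism {0..1} {0..1} f f') \<and> strict_mono_on {0..1} f"

text \<open>As elements of \<^const>\<open>BijGroup\<close>, the members of \<open>G\<close> are
  extensional functions, so each homeomorphism of the interval is represented by exactly one
  function on the reals.\<close>

definition orientation_preserving_homeo_group :: "(real \<Rightarrow> real) set \<Rightarrow> bool" where
  "orientation_preserving_homeo_group G \<longleftrightarrow>
     subgroup G (BijGroup {0..1}) \<and> (\<forall>g\<in>G. orientation_preserving_homeo g)"

definition finitely_generated_in :: "('a, 'b) monoid_scheme \<Rightarrow> 'a set \<Rightarrow> bool" where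
  "finitely_generated_in A G \<longleftrightarrow> (\<exists>S. finite S \<and> S \<subseteq> G \<and> generate A S = G)"

definition fixed_points_accumulate_at :: "(real \<Rightarrow> real) \<Rightarrow> real \<Rightarrow> bool" where
  "fixed_points_accumulate_at g c \<longleftrightarrow>
     (\<forall>U. openin (top_of_set {0..1}) U \<and> c \<in> U \<longrightarrow> (\<exists>x\<in>U. x \<in> {0<..<1} \<and> g x = x))"

definition invariant_under :: "('a \<Rightarrow> 'a) set \<Rightarrow> 'a set \<Rightarrow> bool" where
  "invariant_under G M \<longleftrightarrow> (\<forall>g\<in>G. g ` M = M)"

text \<open>The conjunct with \<^const>\<open>closedin\<close> includes \<open>M \<subseteq> {0<..<1}\<close>.\<close>

definition nonempty_closed_invariant :: "(real \<Rightarrow> real) set \<Rightarrow> real set \<Rightarrow> bool" where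
  "nonempty_closed_invariant G M \<longleftrightarrow>
     M \<noteq> {} \<and> closedin (top_of_set {0<..<1}) M \<and> invariant_under G M"

end

theory Submission
  imports Defs
begin

text \<open>In both cases a finite set \<open>S \<subseteq> G\<close> has no common fixed point near \<open>0\<close> and near \<open>1\<close>,
  say in \<open>(0,p] \<union> [q,1)\<close>: take a generating set and \<open>p = q\<close> in case (1), and \<open>S = {g}\<close> in
  case (2). Choose \<open>b < 1\<close> beyond \<open>p\<close> and all \<open>s p\<close>, \<open>s\<inverse> p\<close> with \<open>s \<in> S\<close>. An invariant set \<open>K\<close>
  that avoids \<open>[p,b]\<close> has no point moved across the gap by \<open>S\<close>, so \<open>K \<inter> (0,p)\<close> is invariant
  under \<open>S\<close>, and if it is nonempty, its supremum is a common fixed point in \<open>(0,p]\<close>.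
  With the mirror argument at \<open>1\<close>, every nonempty invariant set meets a fixed compact interval
  \<open>[a,b] \<subseteq> (0,1)\<close>. Hence chains of nonempty closed invariant sets have nonempty intersection, and
  Zorn's lemma applies.\<close>

section \<open>Order automorphisms of the open interval\<close>

text \<open>These are the order automorphisms of (0,1). Being described by order alone, they need no
  continuity argument below, and conjugation by x -> 1 - x preserves them.\<close>

definition increasing_bij :: "(real \<Rightarrow> real) \<Rightarrow> bool" where
  "increasing_bij s \<longleftrightarrow> strict_mono_on {0<..<1} s \<and> s ` {0<..<1} = {0<..<1}"

lemma increasing_bij_less_iff:
  assumes "increasing_bij s" "x \<in> {0<..<1}" "y \<in> {0<..<1}"
  shows "s x < s y \<longleftrightarrow> x < y"
proof -
  have "strict_mono_on {0<..<1} s"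
    using assms(1) unfolding increasing_bij_def by simp
  then show ?thesis
    using assms(2,3) strict_mono_onD[of "{0<..<1}" s x y] strict_mono_onD[of "{0<..<1}" s y x]
    by (cases x y rule: linorder_cases) auto
qed

lemma increasing_bij_mem: "increasing_bij s \<Longrightarrow> x \<in> {0<..<1} \<Longrightarrow> s x \<in> {0<..<1}"
  unfolding increasing_bij_def by (metis image_eqI)

lemma increasing_bij_preimage:
  assumes "increasing_bij s" "y \<in> {0<..<1}"
  obtains x where "x \<in> {0<..<1}" "s x = y"
proof -
  have "y \<in> s ` {0<..<1}"
    using assms unfolding increasing_bij_def by simp
  then show ?thesis
    using that by blast
qed

text \<open>An order automorphism commutes with suprema, so it fixes the supremum of a set that it
  maps onto itself.\<close>

lemma increasing_bij_fixes_Sup: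
  assumes s: "increasing_bij s" and L: "L \<subseteq> {0<..<1}" "L \<noteq> {}" "s ` L = L"
    and c: "Sup L \<in> {0<..<1}"
  shows "s (Sup L) = Sup L"
proof -
  have bdd: "bdd_above L"
    using L(1) by (meson bdd_above_Ioo bdd_above_mono)
  have up: "y \<le> Sup L" if "y \<in> L" for y
    using that bdd by (rule cSup_upper)
  show ?thesis
  proof (rule linorder_cases)
    assume "s (Sup L) < Sup L"
    then obtain y where y: "y \<in> L" "s (Sup L) < y"
      using less_cSup_iff[OF L(2) bdd] by blast
    then obtain x where "x \<in> L" "y = s x"
      using L(3) by blast
    then show ?thesis
      using y up[of x] increasing_bij_less_iff[OF s c, of x] L(1) by auto
  next
    assume less: "Sup L < s (Sup L)"
    \<comment> \<open>Pulling \<open>Sup L\<close> back to \<open>d\<close> leaves room below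
      \<open>Sup L\<close> for a point of \<open>L\<close> beyond \<open>d\<close>; its image would
      exceed \<open>Sup L\<close>.\<close>
    obtain d where d: "d \<in> {0<..<1}" "s d = Sup L"
      using increasing_bij_preimage[OF s c] .
    then have "d < Sup L"
      using less increasing_bij_less_iff[OF s d(1) c] by simp
    then obtain y where y: "y \<in> L" "d < y"
      using less_cSup_iff[OF L(2) bdd] by blast
    then have "Sup L < s y"
      using increasing_bij_less_iff[OF s d(1), of y] d(2) L(1) by auto
    moreover have "s y \<in> L"
      using y(1) L(3) by blast
    ultimately show ?thesis
      using up by fastforce
  qed
qed

section \<open>Gaps in invariant sets force common fixed points near the ends\<close>

text \<open>The condition \<open>p \<le> s b\<close> expresses that the inverse of \<open>s\<close>
  sends \<open>p\<close> to at most \<open>b\<close>. Together the two bounds prevent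
  \<open>s\<close> from carrying points across [p,b] in either direction.\<close>

lemma finite_common_upper_bound:
  assumes "finite S" "\<And>s. s \<in> S \<Longrightarrow> increasing_bij s" and p: "p \<in> {0<..<1}"
  shows "\<exists>b\<in>{p..<1}. \<forall>s\<in>S. s p \<le> b \<and> p \<le> s b"
  using assms(1,2)
proof (induction S rule: finite_induct)
  case empty
  then show ?case
    using p by auto
next
  case (insert s S)
  then obtain b where b: "b \<in> {p..<1}" "\<forall>s\<in>S. s p \<le> b \<and> p \<le> s b"
    by auto
  have s: "increasing_bij s"
    using insert.prems by simp
  obtain t where t: "t \<in> {0<..<1}" "s t = p"
    using increasing_bij_preimage[OF s p] .
  \<comment> \<open>Enlarging the old bound keeps both conditions for the maps in \<open>S\<close>,
    the second one by monotonicity; \<open>t\<close> is the preimage of \<open>p\<close> under the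
    new map.\<close>
  define b' where "b' = max b (max t (s p))"
  have b': "b' \<in> {p..<1}" "b' \<in> {0<..<1}"
    using b(1) t(1) p increasing_bij_mem[OF s p] by (auto simp: b'_def)
  have "r p \<le> b' \<and> p \<le> r b'" if "r \<in> insert s S" for r
  proof (cases "r = s")
    case True
    then show ?thesis
      using increasing_bij_less_iff[OF s b'(2) t(1)] t(2) by (force simp: b'_def)
  next
    case False
    then have "r \<in> S" "increasing_bij r"
      using that insert.prems by auto
    then show ?thesis
      using b p b'(2) increasing_bij_less_iff[of r b' b] by (force simp: b'_def)
  qed
  then show ?case
    using b'(1) by blast
qed

text \<open>The bound \<open>b\<close> is chosen before \<open>K\<close>, so that a single interval
  [p,b] serves all invariant sets; this uniformity later yields one compact set.\<close>

lemma common_fixed_point_low: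
  assumes fin: "finite S" and S: "\<And>s. s \<in> S \<Longrightarrow> increasing_bij s" and p: "p \<in> {0<..<1}"
  shows "\<exists>b\<in>{p..<1}. \<forall>K. K \<subseteq> {0<..<1} \<and> (\<forall>s\<in>S. s ` K = K) \<and> K \<inter> {p..b} = {} \<and> K \<inter> {0<..<p} \<noteq> {}
           \<longrightarrow> (\<exists>c\<in>{0<..p}. \<forall>s\<in>S. s c = c)"
proof -
  obtain b where b: "b \<in> {p..<1}" "\<forall>s\<in>S. s p \<le> b \<and> p \<le> s b"
    using finite_common_upper_bound[OF assms] by blast
  have b01: "b \<in> {0<..<1}"
    using b(1) p by auto
  have "\<exists>c\<in>{0<..p}. \<forall>s\<in>S. s c = c"
    if K: "K \<subseteq> {0<..<1}" "\<forall>s\<in>S. s ` K = K" "K \<inter> {p..b} = {}" "K \<inter> {0<..<p} \<noteq> {}" for K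
  proof -
    define L where "L = K \<inter> {0<..<p}"
    have L: "L \<subseteq> {0<..<1}" "L \<noteq> {}"
      using K unfolding L_def by auto
    have inv: "s ` L = L" if "s \<in> S" for s
    proof -
      have s: "increasing_bij s" "s ` K = K" "s p \<le> b" "p \<le> s b"
        using S b K(2) that by auto
      \<comment> \<open>Points below \<open>p\<close> land below \<open>s p \<le> b\<close>, points
        above \<open>b\<close> land above \<open>s b \<ge> p\<close>. As the image lies in
        \<open>K\<close> and \<open>K\<close> avoids [p,b], sides are kept.\<close>
      have gap: "s x < p \<longleftrightarrow> x < p" if "x \<in> K" for x
      proof -
        have x: "x \<in> {0<..<1}" "s x \<in> K"
          using that K(1) s(2) by auto
        then have alt: "x < p \<or> b < x" "s x < p \<or> b < s x"
          using that K(3) by force+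
        have "x < p \<Longrightarrow> s x < s p" "b < x \<Longrightarrow> s b < s x"
          using increasing_bij_less_iff[OF s(1)] x(1) p b01 by auto
        then show ?thesis
          using alt s(3,4) b(1) by auto
      qed
      have "L = {x \<in> K. x < p}"
        using K(1) unfolding L_def by auto
      moreover have "s ` {x \<in> K. x < p} = {y \<in> s ` K. y < p}"
        using gap by blast
      ultimately show ?thesis
        using s(2) by simp
    qed
    have "bdd_above L"
      using L(1) by (meson bdd_above_Ioo bdd_above_mono)
    moreover obtain y where "y \<in> L" "0 < y"
      using L by fastforce
    ultimately have "0 < Sup L"
      by (meson cSup_upper less_le_trans)
    moreover have "Sup L \<le> p"
      using L(2) by (intro cSup_least) (auto simp: L_def)
    ultimately have "Sup L \<in> {0<..p}" "Sup L \<in> {0<..<1}"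
      using p by auto
    then show ?thesis
      using increasing_bij_fixes_Sup[OF S L inv] by blast
  qed
  then show ?thesis
    using b(1) by blast
qed

text \<open>Conjugation by x -> 1 - x reverses the order twice. It transfers statements about the
  end 0 to the end 1.\<close>

lemma increasing_bij_reflect:
  assumes "increasing_bij s"
  shows "increasing_bij (\<lambda>x. 1 - s (1 - x))"
proof -
  have "strict_mono_on {0<..<1} (\<lambda>x. 1 - s (1 - x))"
    using increasing_bij_less_iff[OF assms] by (intro strict_mono_onI) auto
  moreover have "y \<in> (\<lambda>x. 1 - s (1 - x)) ` {0<..<1}" if y: "y \<in> {0<..<1}" for y
  proof -
    obtain x where "x \<in> {0<..<1}" "s x = 1 - y"
      using increasing_bij_preimage[OF assms, of "1 - y"] y by auto
    then show ?thesis
      by (intro image_eqI[of _ _ "1 - x"]) auto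
  qed
  moreover have "1 - s (1 - x) \<in> {0<..<1}" if "x \<in> {0<..<1}" for x
    using increasing_bij_mem[OF assms, of "1 - x"] that by auto
  ultimately show ?thesis
    unfolding increasing_bij_def by blast
qed

lemma common_fixed_point_high:
  assumes fin: "finite S" and S: "\<And>s. s \<in> S \<Longrightarrow> increasing_bij s" and q: "q \<in> {0<..<1}"
  shows "\<exists>a\<in>{0<..q}. \<forall>K. K \<subseteq> {0<..<1} \<and> (\<forall>s\<in>S. s ` K = K) \<and> K \<inter> {a..q} = {} \<and> K \<inter> {q<..<1} \<noteq> {}
           \<longrightarrow> (\<exists>c\<in>{q..<1}. \<forall>s\<in>S. s c = c)"
proof -
  \<comment> \<open>The low case is applied at \<open>1 - q\<close> to the conjugates
    \<open>R s\<close> and the reflected set; then \<open>a = 1 - b\<close>, and a common fixed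
    point is reflected back.\<close>
  define R where "R = (\<lambda>s x. 1 - s (1 - x :: real) :: real)"
  have RS: "finite (R ` S)" "\<And>r. r \<in> R ` S \<Longrightarrow> increasing_bij r"
    using fin S increasing_bij_reflect unfolding R_def by auto
  have "1 - q \<in> {0<..<1}"
    using q by simp
  from common_fixed_point_low[OF RS this]
  obtain b where b: "b \<in> {1 - q..<1}"
    and low: "\<forall>K. K \<subseteq> {0<..<1} \<and> (\<forall>r\<in>R ` S. r ` K = K) \<and> K \<inter> {1 - q..b} = {} \<and>
                K \<inter> {0<..<1 - q} \<noteq> {} \<longrightarrow> (\<exists>c\<in>{0<..1 - q}. \<forall>r\<in>R ` S. r c = c)"
    by (rule bexE)
  have "\<exists>c\<in>{q..<1}. \<forall>s\<in>S. s c = c"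
    if K: "K \<subseteq> {0<..<1}" "\<forall>s\<in>S. s ` K = K" "K \<inter> {1 - b..q} = {}" "K \<inter> {q<..<1} \<noteq> {}" for K
  proof -
    let ?K = "(\<lambda>x. 1 - x) ` K"
    have "\<forall>r\<in>R ` S. r ` ?K = ?K"
    proof
      fix r assume "r \<in> R ` S"
      then obtain s where s: "s \<in> S" "r = R s"
        by blast
      have "r ` ?K = (\<lambda>x. 1 - x) ` (s ` K)"
        by (simp add: s(2) R_def image_image)
      then show "r ` ?K = ?K"
        using K(2) s(1) by simp
    qed
    moreover have "?K \<subseteq> {0<..<1}"
      using K(1) by auto
    moreover have "?K \<inter> {1 - q..b} = {}"
      using K(3) by (auto simp: disjoint_iff)
    moreover have "?K \<inter> {0<..<1 - q} \<noteq> {}"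
      using K(4) by (force simp: disjoint_iff)
    ultimately have "\<exists>c\<in>{0<..1 - q}. \<forall>r\<in>R ` S. r c = c"
      by (intro low[THEN spec, THEN mp] conjI)
    then obtain c where "c \<in> {0<..1 - q}" "\<forall>r\<in>R ` S. r c = c"
      by (rule bexE)
    then show ?thesis
      by (intro bexI[of _ "1 - c"]) (auto simp: R_def)
  qed
  then show ?thesis
    using b q by (intro bexI[of _ "1 - b"]) auto
qed

section \<open>Translating the hypotheses on the group\<close>

lemma orientation_preserving_homeo_increasing_bij:
  assumes "orientation_preserving_homeo g"
  shows "increasing_bij g"
proof -
  have mono: "strict_mono_on {0..1} g" and img: "g ` {0..1} = {0..1}"
    using assms unfolding orientation_preserving_homeo_def homeomorphism_def by auto
  have less: "g x < g y \<longleftrightarrow> x < y" if "x \<in> {0..1}" "y \<in> {0..1}" for x y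
    using that strict_mono_onD[OF mono, of x y] strict_mono_onD[OF mono, of y x]
    by (cases x y rule: linorder_cases) auto
  have mem: "g x \<in> {0..1}" if "x \<in> {0..1}" for x
    using img that by blast
  have pre: "\<exists>x\<in>{0..1}. g x = y" if "y \<in> {0..1}" for y
    using img that by (metis imageE)
  have "g x \<in> {0<..<1}" if "x \<in> {0<..<1}" for x
    using less[of 0 x] less[of x 1] mem[of 0] mem[of 1] that by auto
  moreover have "y \<in> g ` {0<..<1}" if y: "y \<in> {0<..<1}" for y
  proof -
    obtain x where x: "x \<in> {0..1}" "g x = y"
      using pre[of y] y by auto
    \<comment> \<open>Preimages of the endpoints enclose \<open>x\<close> strictly, which already
      makes \<open>x\<close> interior.\<close>
    obtain u where u: "u \<in> {0..1}" "g u = 0"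
      using pre[of 0] by auto
    obtain v where v: "v \<in> {0..1}" "g v = 1"
      using pre[of 1] by auto
    have "u < x" "x < v"
      using less[of u x] less[of x v] u v x y by auto
    then show ?thesis
      using u(1) v(1) x by (intro image_eqI[of _ _ x]) auto
  qed
  moreover have "strict_mono_on {0<..<1} g"
    using mono by (rule monotone_on_subset) auto
  ultimately show ?thesis
    unfolding increasing_bij_def by blast
qed

lemma generate_BijGroup_fixed_point:
  assumes S: "S \<subseteq> Bij A" and c: "c \<in> A" "\<forall>s\<in>S. s c = c"
    and g: "g \<in> generate (BijGroup A) S"
  shows "g c = c"
proof -
  \<comment> \<open>Membership in \<open>Bij A\<close> is carried along because the formulas for
    product and inverse in \<open>BijGroup A\<close> are used for bijections.\<close>
  have "g \<in> Bij A \<and> g c = c"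
    using g
  proof (induction rule: generate.induct)
    case one
    have "\<one>\<^bsub>BijGroup A\<^esub> = (\<lambda>x\<in>A. x)"
      by (simp add: BijGroup_def)
    then show ?case
      using id_Bij[of A] c(1) by (metis restrict_apply')
  next
    case (incl h)
    then show ?case
      using S c by auto
  next
    case (inv h)
    then have h: "h \<in> Bij A" "h c = c"
      using S c by auto
    then have "inj_on h A"
      by (auto simp: Bij_def bij_betw_def)
    then have "inv_into A h c = c"
      using inv_into_f_f[of h A c] c(1) h(2) by simp
    then show ?case
      using h(1) c(1) restrict_inv_into_Bij[OF h(1)]
      by (metis inv_BijGroup restrict_apply')
  next
    case (eng h1 h2)
    then have "h1 \<otimes>\<^bsub>BijGroup A\<^esub> h2 = compose A h1 h2"
      by (simp add: BijGroup_def)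
    then show ?case
      using eng.IH compose_Bij c(1) by (metis compose_eq)
  qed
  then show ?thesis ..
qed

text \<open>The cap 1/2 here and the lower bound 1/2 at the other end guarantee
  \<open>p \<le> q\<close> when both are combined.\<close>

lemma not_accumulate_at_0:
  assumes "\<not> fixed_points_accumulate_at g 0"
  shows "\<exists>p\<in>{0<..1/2}. \<forall>x\<in>{0<..p}. g x \<noteq> x"
proof -
  obtain U where U: "openin (top_of_set {0..1}) U" "0 \<in> U" "\<forall>x\<in>U. x \<in> {0<..<1} \<longrightarrow> g x \<noteq> x"
    using assms unfolding fixed_points_accumulate_at_def by blast
  then obtain e where e: "e > 0" "ball 0 e \<inter> {0..1} \<subseteq> U"
    by (auto simp: openin_contains_ball)
  define p where "p = min (e/2) (1/2)"
  have "g x \<noteq> x" if "x \<in> {0<..p}" for x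
  proof -
    have "x \<in> ball 0 e \<inter> {0..1}" "x \<in> {0<..<1}"
      using that e(1) by (auto simp: p_def dist_real_def)
    then show ?thesis
      using e(2) U(3) by blast
  qed
  then show ?thesis
    using e(1) by (intro bexI[of _ p]) (auto simp: p_def)
qed

lemma not_accumulate_at_1:
  assumes "\<not> fixed_points_accumulate_at g 1"
  shows "\<exists>q\<in>{1/2..<1}. \<forall>x\<in>{q..<1}. g x \<noteq> x"
proof -
  obtain U where U: "openin (top_of_set {0..1}) U" "1 \<in> U" "\<forall>x\<in>U. x \<in> {0<..<1} \<longrightarrow> g x \<noteq> x"
    using assms unfolding fixed_points_accumulate_at_def by blast
  then obtain e where e: "e > 0" "ball 1 e \<inter> {0..1} \<subseteq> U"
    by (auto simp: openin_contains_ball)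
  define q where "q = max (1 - e/2) (1/2)"
  have "g x \<noteq> x" if "x \<in> {q..<1}" for x
  proof -
    have "x \<in> ball 1 e \<inter> {0..1}" "x \<in> {0<..<1}"
      using that e(1) by (auto simp: q_def dist_real_def)
    then show ?thesis
      using e(2) U(3) by blast
  qed
  then show ?thesis
    using e(1) by (intro bexI[of _ q]) (auto simp: q_def)
qed

section \<open>A compact interval meeting every invariant set, and Zorn's lemma\<close>

lemma compact_meets_all_invariant_sets:
  assumes fin: "finite S" and S: "\<forall>s\<in>S. increasing_bij s"
    and pq: "0 < p" "p \<le> q" "q < 1"
    and low: "\<not> (\<exists>c\<in>{0<..p}. \<forall>s\<in>S. s c = c)" and high: "\<not> (\<exists>c\<in>{q..<1}. \<forall>s\<in>S. s c = c)"
  shows "\<exists>a b. {a..b} \<subseteq> {0<..<1} \<and>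
           (\<forall>K. K \<subseteq> {0<..<1} \<and> K \<noteq> {} \<and> (\<forall>s\<in>S. s ` K = K) \<longrightarrow> K \<inter> {a..b} \<noteq> {})"
proof -
  have mem: "p \<in> {0<..<1}" "q \<in> {0<..<1}"
    using pq by auto
  obtain b where b: "b \<in> {p..<1}" "\<And>K. K \<subseteq> {0<..<1} \<Longrightarrow> \<forall>s\<in>S. s ` K = K \<Longrightarrow>
      K \<inter> {p..b} = {} \<Longrightarrow> K \<inter> {0<..<p} = {}"
    using common_fixed_point_low[OF fin S[rule_format] mem(1)] low by meson
  obtain a where a: "a \<in> {0<..q}" "\<And>K. K \<subseteq> {0<..<1} \<Longrightarrow> \<forall>s\<in>S. s ` K = K \<Longrightarrow>
      K \<inter> {a..q} = {} \<Longrightarrow> K \<inter> {q<..<1} = {}"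
    using common_fixed_point_high[OF fin S[rule_format] mem(2)] high by meson
  \<comment> \<open>This hull contains [p,b], [a,q] and [p,q]. A set avoiding it has no point in the
    middle, and the two gap results exclude points in (0,p) and (q,1).\<close>
  let ?C = "{min a p..max b q}"
  have "K \<inter> ?C \<noteq> {}" if K: "K \<subseteq> {0<..<1}" "K \<noteq> {}" "\<forall>s\<in>S. s ` K = K" for K
  proof
    assume disj: "K \<inter> ?C = {}"
    have "{p..b} \<subseteq> ?C" "{a..q} \<subseteq> ?C" "{p..q} \<subseteq> ?C"
      by auto
    then have "K \<inter> {p..b} = {}" "K \<inter> {a..q} = {}" "K \<inter> {p..q} = {}"
      using disj by blast+
    moreover from this have "K \<inter> {0<..<p} = {}" "K \<inter> {q<..<1} = {}"
      using a b K by blast+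
    moreover have "{0<..<1} \<subseteq> {0<..<p} \<union> {p..q} \<union> {q<..<1}"
      by auto
    ultimately show False
      using K(1,2) by blast
  qed
  moreover have "?C \<subseteq> {0<..<1}"
    using a(1) b(1) pq by auto
  ultimately show ?thesis
    by (intro exI[of _ "min a p"] exI[of _ "max b q"]) simp
qed

text \<open>Injective maps commute with intersections of nonempty families.\<close>

lemma invariant_under_Inter:
  assumes "\<And>g. g \<in> G \<Longrightarrow> inj_on g A" and "F \<noteq> {}" "\<And>K. K \<in> F \<Longrightarrow> K \<subseteq> A \<and> invariant_under G K"
  shows "invariant_under G (\<Inter>F)"
  unfolding invariant_under_def
proof
  fix g assume g: "g \<in> G"
  have "g ` \<Inter>F = (\<Inter>K\<in>F. g ` K)"
    using image_INT[OF assms(1)[OF g], of F "\<lambda>K. K"] assms(2,3) by auto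
  also have "\<dots> = \<Inter>F"
    using assms(3) g unfolding invariant_under_def by simp
  finally show "g ` \<Inter>F = \<Inter>F" .
qed

lemma minimal_of_compact_meeting:
  assumes inj: "\<And>g. g \<in> G \<Longrightarrow> inj_on g {0<..<1}"
    and C: "compact C" "C \<subseteq> {0<..<1}" "\<And>K. nonempty_closed_invariant G K \<Longrightarrow> K \<inter> C \<noteq> {}"
    and M: "nonempty_closed_invariant G M"
  shows "\<exists>K\<subseteq>M. nonempty_closed_invariant G K \<and> (\<forall>L. L \<subset> K \<longrightarrow> \<not> nonempty_closed_invariant G L)"
proof -
  define A where "A = {K. K \<subseteq> M \<and> nonempty_closed_invariant G K}"
  \<comment> \<open>Zorn's lemma is used for reverse inclusion: an upper bound of a chain is its
    intersection, and a maximal element is a minimal set.\<close>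
  have "\<exists>m\<in>A. \<forall>a\<in>A. a \<subseteq> m \<longrightarrow> a = m"
  proof (rule predicate_Zorn)
    show "partial_order_on A (relation_of (\<lambda>X Y. Y \<subseteq> X) A)"
      by (rule partial_order_on_relation_ofI) auto
  next
    fix F assume F: "F \<in> Chains (relation_of (\<lambda>X Y. Y \<subseteq> X) A)"
    then have chain: "\<And>X Y. X \<in> F \<Longrightarrow> Y \<in> F \<Longrightarrow> X \<subseteq> Y \<or> Y \<subseteq> X" and FA: "F \<subseteq> A"
      unfolding Chains_def relation_of_def by auto
    show "\<exists>u\<in>A. \<forall>a\<in>F. u \<subseteq> a"
    proof (cases "F = {}")
      case True
      then show ?thesis
        using M unfolding A_def by auto
    next
      case False
      have F': "closedin (top_of_set {0<..<1}) K" "invariant_under G K" "K \<subseteq> {0<..<1}"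
        "K \<inter> C \<noteq> {}" if "K \<in> F" for K
        using that FA C(3)[of K] closedin_imp_subset
        unfolding A_def nonempty_closed_invariant_def by blast+
      have "\<Inter>((\<lambda>K. K \<inter> C) ` F) \<noteq> {}"
      proof (rule compact_chain)
        fix T assume "T \<in> (\<lambda>K. K \<inter> C) ` F"
        then obtain K where K: "K \<in> F" "T = K \<inter> C"
          by blast
        obtain D where D: "closed D" "K = {0<..<1} \<inter> D"
          using F'(1)[OF K(1)] by (auto simp: closedin_closed)
        \<comment> \<open>\<open>K\<close> is closed only relative to (0,1), but its trace on
          \<open>C\<close> is compact because \<open>C\<close> lies inside (0,1).\<close>
        have "T = C \<inter> D"
          using C(2) K(2) D(2) by blast
        then show "compact T"
          using C(1) D(1) by (simp add: compact_Int_closed)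
      next
        show "{} \<notin> (\<lambda>K. K \<inter> C) ` F"
          using F'(4) by blast
      next
        fix S T assume "S \<in> (\<lambda>K. K \<inter> C) ` F \<and> T \<in> (\<lambda>K. K \<inter> C) ` F"
        then show "S \<subseteq> T \<or> T \<subseteq> S"
          using chain by blast
      qed
      then have "\<Inter>F \<noteq> {}"
        by blast
      moreover have "closedin (top_of_set {0<..<1}) (\<Inter>F)"
        using False F'(1) by (intro closedin_Inter) auto
      moreover have "invariant_under G (\<Inter>F)"
        using inj False F' by (intro invariant_under_Inter[of G "{0<..<1}"]) auto
      moreover have "\<Inter>F \<subseteq> M"
        using False FA unfolding A_def by blast
      ultimately have "\<Inter>F \<in> A"
        unfolding A_def nonempty_closed_invariant_def by blast
      then show ?thesis
        by blast
    qed
  qed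
  then obtain m where "m \<in> A" and min: "\<And>a. a \<in> A \<Longrightarrow> a \<subseteq> m \<Longrightarrow> a = m"
    by blast
  then have "m \<subseteq> M" "nonempty_closed_invariant G m"
    unfolding A_def by auto
  moreover have "\<not> nonempty_closed_invariant G L" if "L \<subset> m" for L
    using min[of L] that \<open>m \<subseteq> M\<close> unfolding A_def by auto
  ultimately show ?thesis
    by blast
qed

theorem lemma1:
  fixes G :: "(real \<Rightarrow> real) set" and M :: "real set"
  assumes "orientation_preserving_homeo_group G"
    and "(finitely_generated_in (BijGroup {0..1}) G \<and>
            \<not> (\<exists>p\<in>{0<..<1}. \<forall>g\<in>G. g p = p))
         \<or> (\<exists>g\<in>G. \<not> fixed_points_accumulate_at g 0 \<and> \<not> fixed_points_accumulate_at g 1)"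
    and "nonempty_closed_invariant G M"
  shows "\<exists>K\<subseteq>M. nonempty_closed_invariant G K \<and>
           (\<forall>L. L \<subset> K \<longrightarrow> \<not> nonempty_closed_invariant G L)"
proof -
  have incr: "increasing_bij g" if "g \<in> G" for g
    using assms(1) that orientation_preserving_homeo_increasing_bij
    unfolding orientation_preserving_homeo_group_def by blast
  have GB: "G \<subseteq> Bij {0..1}"
    using assms(1) subgroup.subset
    unfolding orientation_preserving_homeo_group_def by (fastforce simp: BijGroup_def)
  \<comment> \<open>Both alternatives are reduced to one condition on a finite subset of
    \<open>G\<close>.\<close>
  have "\<exists>S p q. finite S \<and> S \<subseteq> G \<and> 0 < p \<and> p \<le> q \<and> q < 1 \<and>
      \<not> (\<exists>c\<in>{0<..p}. \<forall>s\<in>S. s c = c) \<and> \<not> (\<exists>c\<in>{q..<1}. \<forall>s\<in>S. s c = c)"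
    using assms(2)
  proof
    assume fg: "finitely_generated_in (BijGroup {0..1}) G \<and>
      \<not> (\<exists>p\<in>{0<..<1}. \<forall>g\<in>G. g p = p)"
    then obtain S where S: "finite S" "S \<subseteq> G" "generate (BijGroup {0..1}) S = G"
      unfolding finitely_generated_in_def by blast
    have "\<not> (\<forall>s\<in>S. s c = c)" if c: "c \<in> {0<..<1}" for c
    proof
      assume "\<forall>s\<in>S. s c = c"
      then have "\<forall>g\<in>G. g c = c"
        using generate_BijGroup_fixed_point[of S "{0..1}" c] S GB c by auto
      then show False
        using fg c by blast
    qed
    then show ?thesis
      \<comment> \<open>The choice \<open>p = q = 1/2\<close> is arbitrary, since \<open>S\<close>
        has no common fixed point anywhere in (0,1).\<close>
      using S(1,2) by (intro exI[of _ S] exI[of _ "1/2"]) auto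
  next
    assume "\<exists>g\<in>G. \<not> fixed_points_accumulate_at g 0 \<and> \<not> fixed_points_accumulate_at g 1"
    then obtain g where g: "g \<in> G" "\<not> fixed_points_accumulate_at g 0"
      "\<not> fixed_points_accumulate_at g 1"
      by blast
    obtain p where "p \<in> {0<..1/2}" "\<forall>x\<in>{0<..p}. g x \<noteq> x"
      using not_accumulate_at_0[OF g(2)] by blast
    moreover obtain q where "q \<in> {1/2..<1}" "\<forall>x\<in>{q..<1}. g x \<noteq> x"
      using not_accumulate_at_1[OF g(3)] by blast
    ultimately show ?thesis
      using g(1) by (intro exI[of _ "{g}"] exI[of _ p] exI[of _ q]) auto
  qed
  then obtain S p q where S: "finite S" "S \<subseteq> G" and pq: "0 < p" "p \<le> q" "q < 1"
      "\<not> (\<exists>c\<in>{0<..p}. \<forall>s\<in>S. s c = c)" "\<not> (\<exists>c\<in>{q..<1}. \<forall>s\<in>S. s c = c)"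
    by blast
  have "\<forall>s\<in>S. increasing_bij s"
    using incr S(2) by blast
  from compact_meets_all_invariant_sets[OF S(1) this pq]
  obtain a b where ab: "{a..b} \<subseteq> {0<..<1}"
    and meets: "\<forall>K. K \<subseteq> {0<..<1} \<and> K \<noteq> {} \<and> (\<forall>s\<in>S. s ` K = K) \<longrightarrow> K \<inter> {a..b} \<noteq> {}"
    by (elim exE conjE)
  show ?thesis
  proof (rule minimal_of_compact_meeting[OF _ _ ab _ assms(3)])
    show "inj_on g {0<..<1}" if "g \<in> G" for g
      using incr[OF that] unfolding increasing_bij_def
      by (simp add: strict_mono_on_imp_inj_on)
    \<comment> \<open>Invariance under \<open>G\<close> implies invariance under the finite set
      \<open>S\<close>, which is all that \<open>meets\<close> asks for besides \<open>K\<close>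
      being a nonempty subset of (0,1).\<close>
    show "K \<inter> {a..b} \<noteq> {}" if "nonempty_closed_invariant G K" for K
    proof (intro meets[THEN spec, THEN mp] conjI)
      show "K \<subseteq> {0<..<1}" "K \<noteq> {}" "\<forall>s\<in>S. s ` K = K"
        using that S(2) closedin_imp_subset
        unfolding nonempty_closed_invariant_def invariant_under_def by blast+
    qed
  qed simp
qed

end
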